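(* Let $H\subseteq V$ be any subset and let $\mathfrak{T}\subseteq\mathrm{TO}(N)$ be a closed subset. Then the set $\min_{\mathfrak{T}}^{\mathrm{lm}}(H)$ of minimal leading monomial ideals of $H$ from $\mathfrak{T}$, i.e. the set of those ideals $\mathrm{LM}_\preceq(H)$ with ${\preceq}\in\mathfrak{T}$ which are minimal with respect to inclusion in $\{\mathrm{LM}_{\preceq'}(H)\mid {\preceq'}\in\mathfrak{T}\}$, is finite.
   Context: $K$ is a field, $t\ge 1$ an integer, $K[X]=K[X_1,\dots,X_t]$ the commutative polynomial ring, $M=\{X^\nu\mid \nu\in\mathbb{N}_0^t\}$ its set of monomials. $V$ is a $K$-module (vector space) with a fixed $K$-module isomorphism $\Phi:V\to K[X]$, and $N=\Phi^{-1}(M)$, a countable $K$-basis of $V$. For a set $S$, $\mathrm{TO}(S)$ is the set of all total orderings on $S$ (antisymmetric, transitive, total binary relations), with the coarsest topology for which all sets $\mathfrak{U}_{(a,b)}=\{{\preceq}\in\mathrm{TO}(S)\mid a\preceq b\}$, $(a,b)\in S\times S$, are open. For $v\in V$, $\mathrm{Supp}(v)\subseteq N$ is the finite set of basis elements occurring with nonzero coefficient in the expansion of $v$ over $N$. For ${\preceq}\in\mathrm{TO}(N)$ and $v\in V\setminus\{0\}$, $\mathrm{lm}_\preceq(v)$ is the $\preceq$-maximal element of $\mathrm{Supp}(v)$, and $\mathrm{LM}_\preceq(v)=\Phi(\mathrm{lm}_\preceq(v))\in M$. For $H\subseteq V$, $\mathrm{LM}_\preceq(H)$ is the ideal of $K[X]$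 generated by $\{\mathrm{LM}_\preceq(h)\mid h\in H\setminus\{0\}\}$. *)

theory Defs
  imports "HOL-Analysis.Function_Topology" "HOL-Library.Poly_Mapping"
begin

section \<open>Total orderings and their topology\<close>

definition total_orders :: "'a set \<Rightarrow> 'a rel set" where
  "total_orders S = {r. linear_order_on S r}"

text \<open>The generator \<open>total_orders S\<close> is redundant unless \<open>S\<close> is empty (it is \<open>{r \<in> total_orders S. (a, a) \<in> r}\<close>
  for any \<open>a \<in> S\<close>); it makes \<open>total_orders S\<close> the underlying set of the topology in every case.\<close>

definition total_orders_topology :: "'a set \<Rightarrow> 'a rel topology" where
  "total_orders_topology S = topology_generated_by
     (insert (total_orders S) {{r \<in> total_orders S. (a, b) \<in> r} | a b. a \<in> S \<and> b \<in> S})"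

lemma topspace_total_orders_topology: "topspace (total_orders_topology S) = total_orders S"
  unfolding total_orders_topology_def topology_generated_by_topspace by auto

section \<open>Polynomials in finitely many variables\<close>

text \<open>The variables are indexed by a finite type \<open>'t\<close>, so their number is \<open>CARD('t) \<ge> 1\<close>.
  Multiplication of \<^typ>\<open>('t \<Rightarrow>\<^sub>0 nat) \<Rightarrow>\<^sub>0 'k\<close> is the convolution product of \<^theory>\<open>HOL-Library.Poly_Mapping\<close>.\<close>

type_synonym ('t, 'k) mpoly = "('t \<Rightarrow>\<^sub>0 nat) \<Rightarrow>\<^sub>0 'k"

definition mpoly_scale :: "'k::field \<Rightarrow> ('t, 'k) mpoly \<Rightarrow> ('t, 'k) mpoly" where
  "mpoly_scale c p = Poly_Mapping.map (\<lambda>x. c * x) p"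

definition monomials :: "('t, 'k::field) mpoly set" where
  "monomials = {Poly_Mapping.single \<nu> 1 | \<nu>. True}"

lemma lookup_mpoly_scale: "Poly_Mapping.lookup (mpoly_scale c p) \<nu> = c * Poly_Mapping.lookup p \<nu>"
  unfolding mpoly_scale_def by (simp add: Poly_Mapping.map.rep_eq when_def)

lemma vector_space_mpoly_scale:
  "vector_space (mpoly_scale :: 'k::field \<Rightarrow> ('t, 'k) mpoly \<Rightarrow> ('t, 'k) mpoly)"
  by unfold_locales
    (auto intro!: poly_mapping_eqI simp: lookup_mpoly_scale lookup_add algebra_simps)

text \<open>Ideals are the submodules of the ring as a module over itself.\<close>

definition ideal_generated :: "'r::comm_ring_1 set \<Rightarrow> 'r set" where
  "ideal_generated B = module.span (*) B"

lemma module_times: "module ((*) :: 'r::comm_ring_1 \<Rightarrow> 'r \<Rightarrow> 'r)"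
  by unfold_locales (simp_all add: algebra_simps)

section \<open>Leading monomial ideals\<close>

definition basis_elements :: "('v \<Rightarrow> ('t, 'k::field) mpoly) \<Rightarrow> 'v set" where
  "basis_elements \<Phi> = \<Phi> -` monomials"

definition Supp ::
  "('k::field \<Rightarrow> 'v::ab_group_add \<Rightarrow> 'v) \<Rightarrow> ('v \<Rightarrow> ('t, 'k) mpoly) \<Rightarrow> 'v \<Rightarrow> 'v set" where
  "Supp smul \<Phi> v = {n. module.representation smul (basis_elements \<Phi>) v n \<noteq> 0}"

definition lm ::
  "('k::field \<Rightarrow> 'v::ab_group_add \<Rightarrow> 'v) \<Rightarrow> ('v \<Rightarrow> ('t, 'k) mpoly) \<Rightarrow> 'v rel \<Rightarrow> 'v \<Rightarrow> 'v" where
  "lm smul \<Phi> r v = (THE n. n \<in> Supp smul \<Phi> v \<and> (\<forall>m \<in> Supp smul \<Phi> v. (m, n) \<in> r))"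

definition LM ::
  "('k::field \<Rightarrow> 'v::ab_group_add \<Rightarrow> 'v) \<Rightarrow> ('v \<Rightarrow> ('t, 'k) mpoly) \<Rightarrow> 'v rel \<Rightarrow> 'v \<Rightarrow> ('t, 'k) mpoly" where
  "LM smul \<Phi> r v = \<Phi> (lm smul \<Phi> r v)"

definition LM_ideal ::
  "('k::field \<Rightarrow> 'v::ab_group_add \<Rightarrow> 'v) \<Rightarrow> ('v \<Rightarrow> ('t, 'k) mpoly) \<Rightarrow> 'v rel \<Rightarrow> 'v set \<Rightarrow>
    ('t, 'k) mpoly set" where
  "LM_ideal smul \<Phi> r H = ideal_generated {LM smul \<Phi> r h | h. h \<in> H - {0}}"

definition min_LM_ideals ::
  "('k::field \<Rightarrow> 'v::ab_group_add \<Rightarrow> 'v) \<Rightarrow> ('v \<Rightarrow> ('t, 'k) mpoly) \<Rightarrow> 'v rel set \<Rightarrow> 'v set \<Rightarrow>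
    ('t, 'k) mpoly set set" where
  "min_LM_ideals smul \<Phi> T H =
     {LM_ideal smul \<Phi> r H | r. r \<in> T \<and> \<not> (\<exists>r' \<in> T. LM_ideal smul \<Phi> r' H \<subset> LM_ideal smul \<Phi> r H)}"

end

theory Submission
  imports Defs
begin

text \<open>By Tychonoff, the space of total orderings is compact. By Dickson's lemma every leading monomial ideal
  of \<open>H\<close> is generated by the leading monomials of finitely many \<open>h \<in> H\<close>, and these leading monomials stay the
  same for all orderings in a neighbourhood of the given one. So the leading monomial ideal can only grow near a
  given ordering; finitely many such neighbourhoods cover \<open>T\<close>, and every minimal ideal is the one attached to
  the centre of one of them.\<close>

section \<open>Compactness of the space of total orderings\<close>

text \<open>Relations are encoded by their characteristic functions, points of the Boolean cube over
  all pairs. Each order axiom restricts only finitely many coordinates at a time, so the codes of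
  orderings form a closed, hence compact, set \<open>L\<close>, and \<open>Collect\<close> maps it
  continuously onto the space in question.\<close>

lemma compact_space_total_orders_topology: "compact_space (total_orders_topology S)"
proof -
  define X where "X = product_topology (\<lambda>_ :: 'a \<times> 'a. discrete_topology (UNIV :: bool set)) UNIV"
  define L where "L = {f. Collect f \<in> total_orders S}"
  have top[simp]: "topspace X = UNIV"
    by (simp add: X_def)
  have compact: "compact_space X"
    by (simp add: X_def compact_space_product_topology compact_space_discrete_topology)
  have proj: "continuous_map X (discrete_topology UNIV) (\<lambda>f. f p)" for p
    unfolding X_def by (rule continuous_map_product_projection) simp
  have cl: "closedin X {f. f p}" "closedin X {f. \<not> f p}" for p
    using closedin_continuous_map_preimage[OF proj, of "{True}" p]
      closedin_continuous_map_preimage[OF proj, of "{False}" p] by simp_all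
  have op: "openin X {f. f p}" for p
    using openin_continuous_map_preimage[OF proj, of "{True}" p] by simp
  have cl_All: "closedin X {f. \<forall>i. P i f}" if "\<And>i. closedin X {f. P i f}" for P :: "'i \<Rightarrow> _ \<Rightarrow> bool"
  proof -
    have "{f. \<forall>i. P i f} = (\<Inter>i. {f. P i f})"
      by auto
    then show ?thesis
      using that by auto
  qed
  have cl_imp: "closedin X {f. A \<longrightarrow> P f}" if "closedin X {f. P f}" for A P
    using that closedin_topspace[of X] by (cases A) simp_all
  have cl_disj: "closedin X {f. P f \<or> Q f}" if "closedin X {f. P f}" "closedin X {f. Q f}" for P Q
    using closedin_Un[OF that] by (simp add: Collect_disj_eq)
  have cl_conj: "closedin X {f. P f \<and> Q f}" if "closedin X {f. P f}" "closedin X {f. Q f}" for P Q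
    using closedin_Int[OF that] by (simp add: Collect_conj_eq)
  \<comment> \<open>The axioms are brought into clausal form: disjunctions of conditions on single
    coordinates, with implications only from premises independent of \<open>f\<close>. This is the
    shape that the closure rules above can handle.\<close>
  have "L = {f. (\<forall>p. p \<notin> S \<times> S \<longrightarrow> \<not> f p) \<and> (\<forall>x. x \<in> S \<longrightarrow> f (x, x)) \<and>
      (\<forall>x y z. \<not> f (x, y) \<or> \<not> f (y, z) \<or> f (x, z)) \<and>
      (\<forall>x y. x \<noteq> y \<longrightarrow> \<not> f (x, y) \<or> \<not> f (y, x)) \<and>
      (\<forall>x y. x \<in> S \<and> y \<in> S \<and> x \<noteq> y \<longrightarrow> f (x, y) \<or> f (y, x))}"
    unfolding L_def total_orders_def order_on_defs refl_on_def trans_def antisym_def total_on_def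
    by (intro Collect_cong) (safe; blast)
  also have "closedin X \<dots>"
    by (intro cl_conj cl_All cl_imp cl_disj cl)
  finally have "compactin X L"
    using closedin_compact_space[OF compact] by blast
  then have "compactin (subtopology X L) L"
    by (simp add: compactin_subtopology)
  \<comment> \<open>Continuity need only be tested on generators: the preimage of the whole space is
    everything, and that of a subbasic set is the trace on \<open>L\<close> of an open
    cylinder.\<close>
  moreover have "continuous_map (subtopology X L) (total_orders_topology S) Collect"
    unfolding total_orders_topology_def
  proof (rule continuous_on_generated_topo)
    fix U assume "U \<in> insert (total_orders S) {{r \<in> total_orders S. (a, b) \<in> r} | a b. a \<in> S \<and> b \<in> S}"
    then consider "U = total_orders S" | a b where "U = {r \<in> total_orders S. (a, b) \<in> r}"
      by auto
    then show "openin (subtopology X L) (Collect -` U \<inter> topspace (subtopology X L))"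
    proof cases
      case 1
      then have "Collect -` U \<inter> topspace (subtopology X L) = topspace (subtopology X L)"
        by (auto simp: L_def)
      then show ?thesis
        by (metis openin_topspace)
    next
      case 2
      then have "Collect -` U \<inter> topspace (subtopology X L) = L \<inter> {f. f (a, b)}"
        by (auto simp: L_def)
      then show ?thesis
        using op by (auto simp: openin_subtopology_Int2)
    qed
  qed (auto simp: L_def)
  ultimately have "compactin (total_orders_topology S) (Collect ` L)"
    by (rule image_compactin)
  moreover have "Collect ` L = total_orders S"
    unfolding L_def by (auto intro!: image_eqI[of _ _ "\<lambda>p. p \<in> _"])
  ultimately show ?thesis
    by (simp add: compact_space_def topspace_total_orders_topology)
qed

section \<open>Dickson's lemma\<close>

text \<open>Every sequence has a monotone subsequence. If that one decreases, it is constant from an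
  index \<open>k\<close> at which it attains its minimum, so its tail is increasing as well.\<close>

lemma nat_seq_incseq_subseq:
  fixes s :: "nat \<Rightarrow> nat"
  shows "\<exists>f. strict_mono f \<and> incseq (\<lambda>n. s (f n))"
proof -
  obtain f where f: "strict_mono f" "monoseq (\<lambda>n. s (f n))"
    using seq_monosub[of s] by blast
  then consider "incseq (\<lambda>n. s (f n))" | "decseq (\<lambda>n. s (f n))"
    by (auto simp: monoseq_iff)
  then show ?thesis
  proof cases
    case 2
    obtain k where k: "\<And>n. s (f k) \<le> s (f n)"
      using ex_has_least_nat[of "\<lambda>_. True" _ "\<lambda>n. s (f n)"] by blast
    have "s (f (n + k)) = s (f k)" for n
      using k[of "n + k"] decseqD[OF 2, of k "n + k"] by simp
    moreover have "strict_mono (\<lambda>n. f (n + k))"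
      using f(1) by (simp add: strict_mono_def)
    ultimately show ?thesis
      by (intro exI[of _ "\<lambda>n. f (n + k)"]) (simp add: incseq_def)
  qed (use f in blast)
qed

text \<open>The coordinates are treated one after another; thinning out further keeps the
  coordinates already treated increasing.\<close>

lemma nat_fun_seq_incseq_subseq:
  fixes s :: "nat \<Rightarrow> 'i \<Rightarrow> nat"
  assumes "finite I"
  shows "\<exists>f. strict_mono f \<and> (\<forall>i\<in>I. incseq (\<lambda>n. s (f n) i))"
  using assms
proof (induction I)
  case empty
  then show ?case
    by (auto intro: strict_mono_id[unfolded id_def])
next
  case (insert j I)
  then obtain f where f: "strict_mono f" "\<forall>i\<in>I. incseq (\<lambda>n. s (f n) i)"
    by blast
  obtain g where g: "strict_mono g" "incseq (\<lambda>n. s (f (g n)) j)"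
    using nat_seq_incseq_subseq[of "\<lambda>n. s (f n) j"] by blast
  have "incseq (\<lambda>n. s (f (g n)) i)" if "i \<in> I" for i
    using f(2) that g(1) by (simp add: incseq_def strict_mono_less_eq)
  then show ?case
    using strict_mono_o[OF f(1) g(1)] g(2) by (intro exI[of _ "\<lambda>n. f (g n)"]) (simp add: o_def)
qed

lemma Dickson:
  fixes A :: "('t::finite \<Rightarrow> nat) set"
  shows "\<exists>F. finite F \<and> F \<subseteq> A \<and> (\<forall>a\<in>A. \<exists>b\<in>F. b \<le> a)"
proof -
  \<comment> \<open>\<open>F\<close> consists of the minimal elements of \<open>A\<close> in the
    componentwise order. It is an antichain, whereas an infinite subset would contain two distinct
    comparable elements.\<close>
  define F where "F = {b \<in> A. \<forall>a\<in>A. a \<le> b \<longrightarrow> a = b}"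
  have "finite F"
  proof (rule ccontr)
    assume "infinite F"
    then obtain s :: "nat \<Rightarrow> _" where s: "inj s" "range s \<subseteq> F"
      using infinite_countable_subset by blast
    obtain f where f: "strict_mono f" "\<And>i. incseq (\<lambda>n. s (f n) i)"
      using nat_fun_seq_incseq_subseq[of UNIV s] by auto
    have "s (f 0) \<le> s (f 1)"
      using f(2) by (auto simp: le_fun_def incseq_def)
    moreover have "s (f 0) \<in> A" "s (f 1) \<in> F"
      using s(2) by (auto simp: F_def)
    ultimately have "s (f 0) = s (f 1)"
      by (simp add: F_def)
    then show False
      using s(1) f(1) by (auto dest!: injD simp: strict_mono_eq)
  qed
  moreover have "\<exists>b\<in>F. b \<le> a" if "a \<in> A" for a
    using that
  \<comment> \<open>Descent below \<open>a\<close> ends at a minimal element because the total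
    degree drops strictly at each step.\<close>
  proof (induction "\<Sum>i\<in>UNIV. a i" arbitrary: a rule: less_induct)
    case less
    show ?case
    proof (cases "a \<in> F")
      case False
      then obtain b where b: "b \<in> A" "b \<le> a" "b \<noteq> a"
        using less.prems by (auto simp: F_def)
      then obtain i where "b i < a i"
        by (metis le_funD le_neq_implies_less ext)
      with b(2) have "(\<Sum>i\<in>UNIV. b i) < (\<Sum>i\<in>UNIV. a i)"
        by (intro sum_strict_mono_ex1) (auto simp: le_fun_def)
      then show ?thesis
        using less.hyps b by (meson order_trans)
    qed auto
  qed
  ultimately show ?thesis
    by (intro exI[of _ F]) (auto simp: F_def)
qed

section \<open>Monomial ideals\<close>

lemma ideal_generated_mono: "B \<subseteq> C \<Longrightarrow> ideal_generated B \<subseteq> ideal_generated C"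
  unfolding ideal_generated_def by (rule module.span_mono[OF module_times])

lemma ideal_generated_subset_iff: "ideal_generated B \<subseteq> ideal_generated C \<longleftrightarrow> B \<subseteq> ideal_generated C"
  unfolding ideal_generated_def
  by (metis module.span_superset module.span_mono module.span_span module_times order_trans)

lemma single_in_ideal_generated:
  fixes \<mu> \<nu> :: "'t \<Rightarrow>\<^sub>0 nat"
  assumes "Poly_Mapping.lookup \<nu> \<le> Poly_Mapping.lookup \<mu>" and "Poly_Mapping.single \<nu> 1 \<in> B"
  shows "(Poly_Mapping.single \<mu> 1 :: ('t, 'k::field) mpoly) \<in> ideal_generated B"
proof -
  \<comment> \<open>Subtraction of exponents is truncated, so this is where divisibility of the
    monomials enters.\<close>
  have "\<mu> - \<nu> + \<nu> = \<mu>"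
    using assms(1) by (auto intro!: poly_mapping_eqI simp: lookup_add lookup_minus le_fun_def)
  then have "Poly_Mapping.single (\<mu> - \<nu>) 1 * Poly_Mapping.single \<nu> 1 =
      (Poly_Mapping.single \<mu> 1 :: ('t, 'k) mpoly)"
    by (simp add: mult_single)
  then show ?thesis
    using assms(2) unfolding ideal_generated_def
    by (metis module.span_base module.span_scale module_times)
qed

text \<open>Dickson's lemma is applied to the exponent vectors. That the finite generating set is
  taken from \<open>B\<close> itself matters later: its members are leading monomials of actual
  elements of \<open>H\<close>.\<close>

lemma ideal_generated_monomials_finite:
  fixes B :: "('t::finite, 'k::field) mpoly set"
  assumes "B \<subseteq> monomials"
  shows "\<exists>F. finite F \<and> F \<subseteq> B \<and> ideal_generated F = ideal_generated B"
proof -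
  define D where "D = {\<nu>. Poly_Mapping.single \<nu> 1 \<in> B}"
  obtain E where "finite E" "E \<subseteq> Poly_Mapping.lookup ` D" "\<forall>a\<in>Poly_Mapping.lookup ` D. \<exists>b\<in>E. b \<le> a"
    using Dickson[of "Poly_Mapping.lookup ` D"] by blast
  then obtain C where C: "finite C" "C \<subseteq> D"
      "\<And>\<mu>. \<mu> \<in> D \<Longrightarrow> \<exists>\<nu>\<in>C. Poly_Mapping.lookup \<nu> \<le> Poly_Mapping.lookup \<mu>"
    using finite_subset_image[of E Poly_Mapping.lookup D] by auto
  define F :: "('t, 'k) mpoly set" where "F = (\<lambda>\<nu>. Poly_Mapping.single \<nu> 1) ` C"
  have "F \<subseteq> B"
    using C(2) by (auto simp: F_def D_def)
  moreover have "B \<subseteq> ideal_generated F"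
  proof
    fix m assume m: "m \<in> B"
    then obtain \<mu> where \<mu>: "m = Poly_Mapping.single \<mu> 1"
      using assms by (auto simp: monomials_def)
    with m obtain \<nu> where "\<nu> \<in> C" "Poly_Mapping.lookup \<nu> \<le> Poly_Mapping.lookup \<mu>"
      using C(3) by (auto simp: D_def)
    then show "m \<in> ideal_generated F"
      unfolding \<mu> by (intro single_in_ideal_generated) (auto simp: F_def)
  qed
  ultimately show ?thesis
    using C(1) ideal_generated_mono[of F B] ideal_generated_subset_iff[of B F]
    by (intro exI[of _ F]) (auto simp: F_def)
qed

section \<open>Supports and leading monomials\<close>

lemma independent_monomials:
  "\<not> module.dependent mpoly_scale (monomials :: ('t, 'k::field) mpoly set)"
proof -
  interpret vector_space "mpoly_scale :: 'k \<Rightarrow> ('t, 'k) mpoly \<Rightarrow> ('t, 'k) mpoly"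
    by (rule vector_space_mpoly_scale)
  have "u p = 0" if "finite A" "A \<subseteq> monomials" "(\<Sum>q\<in>A. mpoly_scale (u q) q) = 0" "p \<in> A"
    for A :: "('t, 'k) mpoly set" and u p
  proof -
    have "p \<in> monomials"
      using that by blast
    then obtain \<nu> where \<nu>: "p = Poly_Mapping.single \<nu> 1"
      by (auto simp: monomials_def)
    have "0 = Poly_Mapping.lookup (\<Sum>q\<in>A. mpoly_scale (u q) q) \<nu>"
      using that by simp
    also have "\<dots> = (\<Sum>q\<in>A. u q * Poly_Mapping.lookup q \<nu>)"
      by (simp add: lookup_sum lookup_mpoly_scale)
    \<comment> \<open>Among all monomials only \<open>p\<close> has a nonzero coefficient at its
      exponent.\<close>
    also have "\<dots> = (\<Sum>q\<in>{p}. u q * Poly_Mapping.lookup q \<nu>)"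
      using that \<nu> by (intro sum.mono_neutral_right)
        (auto simp: monomials_def lookup_single when_def split: if_splits)
    finally show ?thesis
      using \<nu> by simp
  qed
  then show ?thesis
    unfolding independent_explicit_module by blast
qed

lemma span_monomials: "module.span mpoly_scale (monomials :: ('t, 'k::field) mpoly set) = UNIV"
proof -
  interpret vector_space "mpoly_scale :: 'k \<Rightarrow> ('t, 'k) mpoly \<Rightarrow> ('t, 'k) mpoly"
    by (rule vector_space_mpoly_scale)
  have "p \<in> span monomials" for p :: "('t, 'k) mpoly"
  proof -
    have "p = (\<Sum>\<nu>\<in>Poly_Mapping.keys p.
        mpoly_scale (Poly_Mapping.lookup p \<nu>) (Poly_Mapping.single \<nu> 1))"
      by (rule poly_mapping_eqI)
        (auto simp: lookup_sum lookup_mpoly_scale lookup_single when_def in_keys_iff if_distrib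
          cong: if_cong)
    also have "\<dots> \<in> span monomials"
      by (intro span_sum span_scale span_base) (auto simp: monomials_def)
    finally show ?thesis .
  qed
  then show ?thesis
    by auto
qed

lemma total_orders_finite_greatest:
  assumes r: "r \<in> total_orders S" and "finite A" "A \<noteq> {}" "A \<subseteq> S"
  shows "\<exists>n\<in>A. \<forall>m\<in>A. (m, n) \<in> r"
  using assms(2-)
proof (induction A rule: finite_ne_induct)
  case (singleton x)
  then show ?case
    using r by (simp add: total_orders_def order_on_defs refl_on_def)
next
  case (insert x A)
  then obtain n where n: "n \<in> A" "\<forall>m\<in>A. (m, n) \<in> r"
    by blast
  have "x \<in> S" "n \<in> S"
    using insert.prems n(1) by auto
  then have "(x, x) \<in> r" "(x, n) \<in> r \<or> (n, x) \<in> r" "trans r"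
    using r unfolding total_orders_def order_on_defs refl_on_def total_on_def by (cases "x = n"; auto)+
  then show ?case
    using n by (metis insertE insertI1 insertI2 transD)
qed

text \<open>Antisymmetry gives the uniqueness that the definite description in \<open>lm\<close>
  requires.\<close>

lemma lm_eqI:
  assumes "r \<in> total_orders S"
    and "n \<in> Supp smul \<Phi> v" and "\<forall>m \<in> Supp smul \<Phi> v. (m, n) \<in> r"
  shows "lm smul \<Phi> r v = n"
  using assms unfolding lm_def total_orders_def order_on_defs
  by (intro the_equality) (auto dest: antisymD)

context
  fixes smul :: "'k::field \<Rightarrow> 'v::ab_group_add \<Rightarrow> 'v"
    and \<Phi> :: "'v \<Rightarrow> ('t, 'k) mpoly"
  assumes vs: "vector_space smul"
    and lin: "Vector_Spaces.linear smul mpoly_scale \<Phi>"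
    and bij: "bij \<Phi>"
begin

lemma image_basis_elements: "\<Phi> ` basis_elements \<Phi> = monomials"
  unfolding basis_elements_def using bij by (simp add: bij_is_surj surj_image_vimage_eq)

lemma independent_basis_elements: "\<not> module.dependent smul (basis_elements \<Phi>)"
proof -
  interpret p: vector_space_pair smul mpoly_scale
    using vs vector_space_mpoly_scale by (simp add: vector_space_pair_def)
  interpret q: vector_space_pair mpoly_scale smul
    using vs vector_space_mpoly_scale by (simp add: vector_space_pair_def)
  \<comment> \<open>A linear left inverse of the bijection \<Phi> is its inverse, hence injective,
    and so carries the independent monomials to an independent set.\<close>
  obtain g where g: "Vector_Spaces.linear mpoly_scale smul g" "g \<circ> \<Phi> = id"
    using p.linear_injective_left_inverse[OF lin bij_is_inj[OF bij]] by blast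
  then have "inj g"
    using bij by (metis bij_is_surj comp_apply id_apply injI surjD)
  then have "p.vs1.independent (g ` monomials)"
    using independent_monomials q.linear_independent_injective_image[OF g(1)]
    by (blast intro: inj_on_subset)
  moreover have "g ` monomials = basis_elements \<Phi>"
    using g(2) by (metis image_basis_elements image_comp image_id id_apply)
  ultimately show ?thesis
    by simp
qed

interpretation vector_space smul
  by (rule vs)

interpretation Vector_Spaces.linear smul mpoly_scale \<Phi>
  by (rule lin)

lemma span_basis_elements: "span (basis_elements \<Phi>) = UNIV"
proof -
  have "\<Phi> ` span (basis_elements \<Phi>) = UNIV"
    using span_image[of "basis_elements \<Phi>"] by (simp add: image_basis_elements span_monomials)
  then show ?thesis
    using bij by (metis UNIV_I bij_is_inj inj_image_mem_iff subsetI top.extremum_uniqueI)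
qed

lemma finite_Supp: "finite (Supp smul \<Phi> v)"
  unfolding Supp_def by (rule finite_representation)

lemma Supp_subset: "Supp smul \<Phi> v \<subseteq> basis_elements \<Phi>"
  unfolding Supp_def by (auto intro: representation_ne_zero)

text \<open>\<open>representation\<close> is zero by default for dependent sets and for vectors
  outside the span, so both basis properties are needed to recover \<open>v\<close> from its
  coefficients.\<close>

lemma Supp_eq_empty_imp: "Supp smul \<Phi> v = {} \<Longrightarrow> v = 0"
  using sum_nonzero_representation_eq[OF independent_basis_elements, of v]
  by (simp add: Supp_def span_basis_elements)

lemma lm_greatest:
  assumes r: "r \<in> total_orders (basis_elements \<Phi>)" and "v \<noteq> 0"
  shows "lm smul \<Phi> r v \<in> Supp smul \<Phi> v \<and> (\<forall>m \<in> Supp smul \<Phi> v. (m, lm smul \<Phi> r v) \<in> r)"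
proof -
  have "Supp smul \<Phi> v \<noteq> {}"
    using \<open>v \<noteq> 0\<close> Supp_eq_empty_imp by blast
  then obtain n where n: "n \<in> Supp smul \<Phi> v" "\<forall>m \<in> Supp smul \<Phi> v. (m, n) \<in> r"
    using total_orders_finite_greatest[OF r finite_Supp _ Supp_subset] by blast
  then show ?thesis
    using lm_eqI[OF r n] by simp
qed

lemma LM_in_monomials:
  assumes "r \<in> total_orders (basis_elements \<Phi>)" and "v \<noteq> 0"
  shows "LM smul \<Phi> r v \<in> monomials"
  using lm_greatest[OF assms] Supp_subset by (auto simp: LM_def basis_elements_def)

text \<open>Having a prescribed leading element means that it dominates the finitely many elements
  of the support, which is a finite intersection of subbasic open sets.\<close>

lemma openin_lm_eq:
  assumes r: "r \<in> total_orders (basis_elements \<Phi>)" and "v \<noteq> 0"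
  shows "openin (total_orders_topology (basis_elements \<Phi>))
    {r' \<in> total_orders (basis_elements \<Phi>). lm smul \<Phi> r' v = lm smul \<Phi> r v}" (is "openin ?X ?U")
proof -
  let ?n = "lm smul \<Phi> r v"
  have n: "?n \<in> Supp smul \<Phi> v"
    using lm_greatest[OF assms] by blast
  have "?U = (\<Inter>m \<in> Supp smul \<Phi> v. {r' \<in> total_orders (basis_elements \<Phi>). (m, ?n) \<in> r'})"
    using n lm_greatest[OF _ \<open>v \<noteq> 0\<close>] by (auto intro: lm_eqI) metis
  also have "openin ?X \<dots>"
  proof (rule openin_INT2)
    show "openin ?X {r' \<in> total_orders (basis_elements \<Phi>). (m, ?n) \<in> r'}" if "m \<in> Supp smul \<Phi> v" for m
      unfolding total_orders_topology_def
      using that n Supp_subset by (intro topology_generated_by_Basis) blast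
  \<comment> \<open>The support contains \<open>?n\<close>, so the intersection is over a nonempty
    index set and stays inside the space.\<close>
  qed (use n finite_Supp in auto)
  finally show ?thesis .
qed

end

section \<open>Semicontinuity of the leading monomial ideal and the covering argument\<close>

lemma LM_ideal_locally_increasing:
  fixes \<Phi> :: "'v::ab_group_add \<Rightarrow> ('t::finite, 'k::field) mpoly"
  assumes "vector_space smul" and "Vector_Spaces.linear smul mpoly_scale \<Phi>" and "bij \<Phi>"
    and r: "r \<in> total_orders (basis_elements \<Phi>)"
  shows "\<exists>U. openin (total_orders_topology (basis_elements \<Phi>)) U \<and> r \<in> U \<and>
    (\<forall>r'\<in>U. LM_ideal smul \<Phi> r H \<subseteq> LM_ideal smul \<Phi> r' H)"
proof -
  note \<Phi> = assms(1-3)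
  let ?X = "total_orders_topology (basis_elements \<Phi>)"
  have "LM smul \<Phi> r ` (H - {0}) \<subseteq> monomials"
    using LM_in_monomials[OF \<Phi> r] by blast
  then obtain F where F: "finite F" "F \<subseteq> LM smul \<Phi> r ` (H - {0})"
      "ideal_generated F = ideal_generated (LM smul \<Phi> r ` (H - {0}))"
    using ideal_generated_monomials_finite by metis
  then obtain G where G: "G \<subseteq> H - {0}" "finite G" "F = LM smul \<Phi> r ` G"
    by (meson finite_subset_image)
  \<comment> \<open>Intersecting with \<open>topspace ?X\<close> covers the case that
    \<open>H\<close> has no nonzero element and \<open>G\<close> is empty.\<close>
  define U where "U = topspace ?X \<inter>
    (\<Inter>h\<in>G. {r' \<in> total_orders (basis_elements \<Phi>). lm smul \<Phi> r' h = lm smul \<Phi> r h})"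
  have "openin ?X U"
    unfolding U_def using G(1,2) openin_lm_eq[OF \<Phi> r] by (subst Int_commute, intro openin_INT) auto
  moreover have "r \<in> U"
    using r by (simp add: U_def topspace_total_orders_topology)
  moreover have "LM_ideal smul \<Phi> r H \<subseteq> LM_ideal smul \<Phi> r' H" if "r' \<in> U" for r'
  proof -
    \<comment> \<open>Only the elements of \<open>G\<close> are sure to keep their leading
      monomials; others in \<open>H\<close> may change theirs, hence an inclusion of ideals and not
      an equality.\<close>
    have "F \<subseteq> LM smul \<Phi> r' ` (H - {0})"
      using that G by (force simp: U_def LM_def)
    then show ?thesis
      unfolding LM_ideal_def Setcompr_eq_image F(3)[symmetric] by (rule ideal_generated_mono)
  qed
  ultimately show ?thesis
    by blast
qed

theorem theorem4p6:
  fixes smul :: "'k::field \<Rightarrow> 'v::ab_group_add \<Rightarrow> 'v"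
    and \<Phi> :: "'v \<Rightarrow> ('t::finite, 'k) mpoly"
    and H :: "'v set"
    and T :: "'v rel set"
  assumes "vector_space smul"
    and "Vector_Spaces.linear smul mpoly_scale \<Phi>"
    and "bij \<Phi>"
    and "closedin (total_orders_topology (basis_elements \<Phi>)) T"
  shows "finite (min_LM_ideals smul \<Phi> T H)"
proof -
  let ?X = "total_orders_topology (basis_elements \<Phi>)"
  have T: "compactin ?X T"
    using closedin_compact_space[OF compact_space_total_orders_topology assms(4)] .
  have "T \<subseteq> total_orders (basis_elements \<Phi>)"
    using closedin_subset[OF assms(4)] by (simp add: topspace_total_orders_topology)
  then have "\<forall>r\<in>T. \<exists>U. openin ?X U \<and> r \<in> U \<and> (\<forall>r'\<in>U. LM_ideal smul \<Phi> r H \<subseteq> LM_ideal smul \<Phi> r' H)"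
    using LM_ideal_locally_increasing[OF assms(1-3)] by blast
  then obtain U where U: "\<And>r. r \<in> T \<Longrightarrow> openin ?X (U r)" "\<And>r. r \<in> T \<Longrightarrow> r \<in> U r"
      "\<And>r r'. r \<in> T \<Longrightarrow> r' \<in> U r \<Longrightarrow> LM_ideal smul \<Phi> r H \<subseteq> LM_ideal smul \<Phi> r' H"
    by metis
  obtain \<F> where "finite \<F>" "\<F> \<subseteq> U ` T" "T \<subseteq> \<Union>\<F>"
    using compactinD[OF T, of "U ` T"] U(1,2) by blast
  then obtain C where C: "finite C" "C \<subseteq> T" "T \<subseteq> (\<Union>c\<in>C. U c)"
    by (metis finite_subset_image)
  have "min_LM_ideals smul \<Phi> T H \<subseteq> (\<lambda>c. LM_ideal smul \<Phi> c H) ` C"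
  proof
    fix I assume "I \<in> min_LM_ideals smul \<Phi> T H"
    then obtain r where r: "r \<in> T" "I = LM_ideal smul \<Phi> r H"
        "\<not> (\<exists>r'\<in>T. LM_ideal smul \<Phi> r' H \<subset> LM_ideal smul \<Phi> r H)"
      unfolding min_LM_ideals_def by blast
    then obtain c where c: "c \<in> C" "r \<in> U c"
      using C(3) by blast
    then have "LM_ideal smul \<Phi> c H \<subseteq> LM_ideal smul \<Phi> r H"
      using C(2) U(3) by blast
    \<comment> \<open>The centre \<open>c\<close> belongs to \<open>T\<close>, so minimality of the
      ideal of \<open>r\<close> rules out a proper inclusion.\<close>
    then show "I \<in> (\<lambda>c. LM_ideal smul \<Phi> c H) ` C"
      using r c C(2) by blast
  qed
  then show ?thesis
    using C(1) finite_surj by blast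
qed

end
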